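(* Let $q\in(0,1)$. If $f(z)=z+\sum_{n=2}^\infty a_nz^n$ belongs to $\mathcal{K}_q$ with the function $g(z)=z/(1-z)$, then for all $n\ge 2$ $$|a_n|\le\frac{1-q}{1-q^n}\,[n+q(n-1)].$$
   Context: $\mathbb{D}=\{z\in\mathbb{C}:|z|<1\}$. $\mathcal{A}$ is the class of functions $f$ analytic in $\mathbb{D}$ with $f(0)=0=f'(0)-1$. $\mathcal{S}^*\subset\mathcal{A}$ is the class of univalent functions $g\in\mathcal{A}$ that are starlike with respect to the origin. For $q\in(0,1)$ and $f\in\mathcal{A}$, the $q$-difference operator is $(D_qf)(z)=\dfrac{f(z)-f(qz)}{z(1-q)}$ for $z\in\mathbb{D}\setminus\{0\}$, and $(D_qf)(0)=f'(0)$. A function $f\in\mathcal{A}$ belongs to $\mathcal{K}_q$ if there exists $g\in\mathcal{S}^*$ such that $$\left|\frac{z}{g(z)}(D_qf)(z)-\frac{1}{1-q}\right|\le\frac{1}{1-q},\quad z\in\mathbb{D}$$ (where $z/g(z)$ is given its limit value $1$ at $z=0$); one then says that $f\in\mathcal{K}_q$ with the function $g$. *)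

theory Defs
  imports "HOL-Complex_Analysis.Complex_Analysis"
begin

(* The open unit disc is "ball 0 1 :: complex set".  Functions on the disc are total functions
   on the complex numbers of which only the values on the disc matter. *)

definition class_A :: "(complex \<Rightarrow> complex) set" where
  "class_A = {f. f holomorphic_on ball 0 1 \<and> f 0 = 0 \<and> deriv f 0 = 1}"

(* HOL-Analysis' starlike leaves the centre of the star existentially quantified;
   here the centre is fixed. *)
definition starlike_wrt :: "complex \<Rightarrow> complex set \<Rightarrow> bool" where
  "starlike_wrt c S \<longleftrightarrow> c \<in> S \<and> (\<forall>w\<in>S. closed_segment c w \<subseteq> S)"

definition class_Sstar :: "(complex \<Rightarrow> complex) set" where
  "class_Sstar = {g \<in> class_A. inj_on g (ball 0 1) \<and> starlike_wrt 0 (g ` ball 0 1)}"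

definition q_diff :: "real \<Rightarrow> (complex \<Rightarrow> complex) \<Rightarrow> complex \<Rightarrow> complex" where
  "q_diff q f z =
     (if z = 0 then deriv f 0 else (f z - f (of_real q * z)) / (z * (1 - of_real q)))"

(* class_K_with q g consists of the f that belong to K_q "with the function g".
   The quotient z / g z takes its limit value 1 at z = 0. *)
definition class_K_with :: "real \<Rightarrow> (complex \<Rightarrow> complex) \<Rightarrow> (complex \<Rightarrow> complex) set" where
  "class_K_with q g = {f \<in> class_A. g \<in> class_Sstar \<and>
     (\<forall>z\<in>ball 0 1.
        cmod ((if z = 0 then 1 else z / g z) * q_diff q f z - 1 / (1 - of_real q))
          \<le> 1 / (1 - q))}"

definition class_K :: "real \<Rightarrow> (complex \<Rightarrow> complex) set" where
  "class_K q = (\<Union>g\<in>class_Sstar. class_K_with q g)"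

end

theory Submission
  imports Defs
begin

text \<open>
  Write \<open>[n] = (1 - q ^ n) / (1 - q)\<close>. Since \<open>f\<close> has Taylor coefficients \<open>0, 1, a 2, a 3, \<dots>\<close>,
  the operator \<open>q_diff q\<close> turns them into \<open>[1], [2] a 2, [3] a 3, \<dots>\<close>. For
  \<open>g z = z / (1 - z)\<close> the factor \<open>z / g z\<close> is \<open>1 - z\<close>, so the function
  \<open>p z = (1 - z) * q_diff q f z\<close> has as coefficients the successive differences
  \<open>[k + 1] a (k + 1) - [k] a k\<close>, and \<open>[n] a n\<close> is the sum of the coefficients of \<open>p\<close>
  of index below \<open>n\<close>.

  Membership in the class says that \<open>w = (1 - q) p - 1\<close> is bounded by \<open>1\<close>, and its value at the
  origin is \<open>- q\<close>. For a function bounded by \<open>1\<close> on the disc every coefficient \<open>w\<^sub>n\<close> with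
  \<open>n \<ge> 1\<close> satisfies \<open>\<bar>w\<^sub>n\<bar> \<le> 1 - \<bar>w\<^sub>0\<bar>\<^sup>2\<close> (lemma \<open>bounded_fps_coeff_le\<close>), here
  \<open>1 - q\<^sup>2\<close>. Thus the coefficients of \<open>p\<close> are \<open>1\<close> and then at most \<open>1 + q\<close> in modulus, and
  \<open>[n] \<bar>a n\<bar> \<le> 1 + (n - 1) (1 + q) = n + q (n - 1)\<close>.

  The bound on \<open>w\<^sub>n\<close> comes by duality: averaging \<open>w\<close> over the unit circle against the kernel
  \<open>z\<^sup>-\<^sup>n (1 + s z\<^sup>n)\<^sup>2\<close> produces \<open>w\<^sub>n + 2 s w\<^sub>0\<close>, while the modulus of the kernel has mean
  \<open>1 + \<bar>s\<bar>\<^sup>2\<close>. As \<open>w\<close> lives on the open disc only, this is done on circles of radius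
  \<open>r < 1\<close> with the kernel rescaled, and then \<open>r\<close> tends to \<open>1\<close>. The choice \<open>\<bar>s\<bar> = \<bar>w\<^sub>0\<bar>\<close> with the right argument gives the claim.
\<close>

section \<open>Coefficients of bounded analytic functions\<close>

text \<open>
  Parseval's identity for the two-term polynomial \<open>1 + s z\<^sup>n\<close>: the cross term
  \<open>2 Re (s z\<^sup>n)\<close> has mean zero because \<open>n\<close> is not zero.
\<close>

lemma has_integral_norm_binomial_square:
  fixes s :: complex
  assumes "n > 0"
  shows "((\<lambda>x. (cmod (1 + s * exp (2 * of_real pi * \<i> * of_real x) ^ n))\<^sup>2)
           has_integral 1 + (cmod s)\<^sup>2) {0..1}"
proof -
  define c where "c = 2 * of_real pi * \<i> * of_nat n"
  have c: "c \<noteq> 0" using assms by (simp add: c_def)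
  define F where "F = (\<lambda>x::real. (1 + (cmod s)\<^sup>2) * x + 2 * Re (s * exp (c * of_real x) / c))"
  have sq: "(cmod (1 + s * exp (2 * of_real pi * \<i> * of_real x) ^ n))\<^sup>2
      = 1 + (cmod s)\<^sup>2 + 2 * Re (s * exp (c * of_real x))" for x :: real
  proof -
    have e: "exp (2 * of_real pi * \<i> * of_real x) ^ n = exp (c * of_real x)"
      by (simp add: c_def exp_of_nat_mult [symmetric] mult_ac)
    have "cmod (exp (c * of_real x)) = 1"
      by (simp add: c_def)
    then have "cmod (s * exp (c * of_real x)) = cmod s"
      by (simp add: norm_mult)
    moreover have "(cmod (1 + u))\<^sup>2 = 1 + (cmod u)\<^sup>2 + 2 * Re u" for u
      unfolding cmod_power2 by (simp add: power2_eq_square algebra_simps)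
    ultimately show ?thesis
      by (simp only: e)
  qed
  have "((\<lambda>x. 1 + (cmod s)\<^sup>2 + 2 * Re (s * exp (c * of_real x))) has_integral F 1 - F 0) {0..1}"
  proof (rule fundamental_theorem_of_calculus)
    fix x :: real
    have "((\<lambda>z. s * exp (c * z) / c) has_field_derivative s * exp (c * of_real x)) (at (of_real x))"
      using c by (auto intro!: derivative_eq_intros)
    then have "((\<lambda>x. s * exp (c * of_real x) / c) has_vector_derivative s * exp (c * of_real x)) (at x)"
      by (rule has_vector_derivative_real_field)
    then have "((\<lambda>x. Re (s * exp (c * of_real x) / c)) has_real_derivative
        Re (s * exp (c * of_real x))) (at x)"
      unfolding has_real_derivative_iff_has_vector_derivative
      by (rule bounded_linear.has_vector_derivative [OF bounded_linear_Re])
    then have "(F has_real_derivative 1 + (cmod s)\<^sup>2 + 2 * Re (s * exp (c * of_real x))) (at x)"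
      unfolding F_def by (rule DERIV_add [OF DERIV_cmult_Id DERIV_cmult])
    then show "(F has_vector_derivative 1 + (cmod s)\<^sup>2 + 2 * Re (s * exp (c * of_real x)))
        (at x within {0..1})"
      using has_real_derivative_iff_has_vector_derivative has_vector_derivative_at_within by blast
  qed simp
  moreover have "exp c = 1"
    unfolding c_def by (subst exp_eq_1) (auto intro!: exI [of _ "int n"])
  then have "F 1 - F 0 = 1 + (cmod s)\<^sup>2"
    by (simp add: F_def)
  ultimately show ?thesis
    by (simp only: sq)
qed

text \<open>
  The kernel estimate on the circle of radius \<open>r\<close>: Cauchy's formula for the coefficient of
  index \<open>n\<close> is applied to \<open>w z (r\<^sup>n + s z\<^sup>n)\<^sup>2\<close>. Only the terms \<open>r\<^sup>2\<^sup>n\<close> and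
  \<open>2 r\<^sup>n s z\<^sup>n\<close> of the square contribute to it.
\<close>

lemma bounded_fps_coeff_kernel_bound:
  assumes hol: "w holomorphic_on ball 0 1"
    and bnd: "\<And>z. z \<in> ball 0 1 \<Longrightarrow> cmod (w z) \<le> 1"
    and W: "w has_fps_expansion W" and n: "n > 0" and r: "0 < r" "r < 1"
  shows "cmod (of_real (r ^ n) * fps_nth W n + 2 * s * fps_nth W 0) \<le> 1 + (cmod s)\<^sup>2"
proof -
  define \<rho> where "\<rho> = r ^ n"
  have \<rho>: "\<rho> > 0" using r by (simp add: \<rho>_def)
  define F where "F = (\<lambda>z. w z * (of_real \<rho> + s * z ^ n)\<^sup>2)"
  define G where "G = W * (fps_const (of_real \<rho>) + fps_const s * fps_X ^ n)\<^sup>2"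
  have FG: "F has_fps_expansion G"
    unfolding F_def G_def power2_eq_square
    by (intro fps_expansion_intros W)
  have "G = fps_const (of_real \<rho> ^ 2) * W + fps_const (2 * of_real \<rho> * s) * (fps_X ^ n * W)
      + fps_const (s ^ 2) * (fps_X ^ (2 * n) * W)"
    unfolding G_def power2_eq_square mult_2 power_add
    by (simp add: algebra_simps flip: fps_const_mult fps_const_add)
  then have "fps_nth G n = of_real \<rho> ^ 2 * fps_nth W n + 2 * of_real \<rho> * s * fps_nth W 0"
    using n by (simp only: fps_add_nth fps_mult_left_const_nth fps_X_power_mult_nth) simp
  then have Gn: "fps_nth G n = of_real \<rho> * (of_real \<rho> * fps_nth W n + 2 * s * fps_nth W 0)"
    by (simp add: algebra_simps power2_eq_square)
  have holF: "F holomorphic_on ball 0 1"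
    unfolding F_def by (intro holomorphic_intros hol)
  have "((\<lambda>u. F u / (u - 0) ^ Suc n) has_contour_integral
      (2 * pi * \<i>) / fact n * (deriv ^^ n) F 0) (circlepath 0 r)"
  proof (rule Cauchy_has_contour_integral_higher_derivative_circlepath)
    show "F holomorphic_on ball 0 r"
      by (rule holomorphic_on_subset [OF holF]) (use r in auto)
    have "F holomorphic_on cball 0 r"
      by (rule holomorphic_on_subset [OF holF]) (use r in auto)
    then show "continuous_on (cball 0 r) F"
      by (rule holomorphic_on_imp_continuous_on)
  qed (use r in auto)
  then have "((\<lambda>u. F u / u ^ Suc n) has_contour_integral 2 * pi * \<i> * fps_nth G n) (circlepath 0 r)"
    by (simp add: fps_nth_fps_expansion [OF FG])
  then have I: "((\<lambda>x. F (circlepath 0 r x) / circlepath 0 r x ^ Suc n *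
      vector_derivative (circlepath 0 r) (at x within {0..1})) has_integral
      2 * pi * \<i> * fps_nth G n) {0..1}"
    by (simp add: has_contour_integral_def)
  have J: "((\<lambda>x. 2 * pi * \<rho> * (cmod (1 + s * exp (2 * of_real pi * \<i> * of_real x) ^ n))\<^sup>2)
      has_integral 2 * pi * \<rho> * (1 + (cmod s)\<^sup>2)) {0..1}"
    by (intro has_integral_mult_right has_integral_norm_binomial_square n)
  have "cmod (2 * pi * \<i> * fps_nth G n) \<le> (2 * pi * \<rho> * (1 + (cmod s)\<^sup>2)) \<bullet> 1"
  proof (rule has_integral_norm_bound_integral_component [OF I J])
    fix x :: real assume x: "x \<in> {0..1}"
    define e where "e = exp (2 * of_real pi * \<i> * of_real x)"
    have e1: "cmod e = 1" by (simp add: e_def)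
    have z: "circlepath 0 r x = of_real r * e"
      by (simp add: circlepath e_def)
    have v: "cmod (vector_derivative (circlepath 0 r) (at x within {0..1})) = 2 * pi * r"
      using x r e1 by (simp add: vector_derivative_circlepath01 norm_mult)
    have "F (of_real r * e) = w (of_real r * e) * (of_real \<rho> * (1 + s * e ^ n))\<^sup>2"
      by (simp add: F_def \<rho>_def power_mult_distrib algebra_simps)
    then have "cmod (F (of_real r * e)) = cmod (w (of_real r * e)) * (\<rho>\<^sup>2 * (cmod (1 + s * e ^ n))\<^sup>2)"
      using \<rho> by (simp add: norm_mult norm_power power_mult_distrib)
    also have "\<dots> \<le> 1 * (\<rho>\<^sup>2 * (cmod (1 + s * e ^ n))\<^sup>2)"
      by (intro mult_right_mono bnd) (use r e1 in \<open>auto simp: norm_mult\<close>)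
    finally have Fb: "cmod (F (of_real r * e)) \<le> \<rho>\<^sup>2 * (cmod (1 + s * e ^ n))\<^sup>2" by simp
    have "cmod (F (of_real r * e) / (of_real r * e) ^ Suc n *
        vector_derivative (circlepath 0 r) (at x within {0..1}))
      = cmod (F (of_real r * e)) / (r * \<rho>) * (2 * pi * r)"
      using r e1 by (simp add: norm_mult norm_divide norm_power v \<rho>_def del: of_real_power)
    also have "\<dots> \<le> (\<rho>\<^sup>2 * (cmod (1 + s * e ^ n))\<^sup>2) / (r * \<rho>) * (2 * pi * r)"
      by (intro mult_right_mono divide_right_mono Fb) (use r \<rho> in auto)
    also have "\<dots> = 2 * pi * \<rho> * (cmod (1 + s * e ^ n))\<^sup>2"
      using r \<rho> by (simp add: power2_eq_square)
    finally show "cmod (F (circlepath 0 r x) / circlepath 0 r x ^ Suc n *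
        vector_derivative (circlepath 0 r) (at x within {0..1}))
      \<le> (2 * pi * \<rho> * (cmod (1 + s * exp (2 * of_real pi * \<i> * of_real x) ^ n))\<^sup>2) \<bullet> 1"
      by (simp add: z e_def)
  qed
  moreover have "cmod (2 * pi * \<i> * fps_nth G n)
      = 2 * pi * \<rho> * cmod (of_real \<rho> * fps_nth W n + 2 * s * fps_nth W 0)"
    unfolding Gn norm_mult [of _ "of_real \<rho> * _"] norm_mult [of "of_real \<rho>"]
    using \<rho> by (simp add: norm_mult [of _ \<i>])
  ultimately have "2 * pi * \<rho> * cmod (of_real \<rho> * fps_nth W n + 2 * s * fps_nth W 0)
      \<le> 2 * pi * \<rho> * (1 + (cmod s)\<^sup>2)"
    by (simp only: inner_real_def mult_1_right)
  then show ?thesis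
    using \<rho> by (subst (asm) mult_le_cancel_left_pos) (simp_all add: \<rho>_def)
qed

text \<open>
  The kernel estimate is optimised at \<open>\<bar>s\<bar> = \<bar>w\<^sub>0\<bar>\<close>, where it reads
  \<open>\<bar>w\<^sub>n\<bar> + 2 \<bar>w\<^sub>0\<bar>\<^sup>2 \<le> 1 + \<bar>w\<^sub>0\<bar>\<^sup>2\<close>. For \<open>n = 1\<close> this is the
  Schwarz-Pick inequality at the origin.
\<close>

lemma bounded_fps_coeff_le:
  assumes hol: "w holomorphic_on ball 0 1"
    and bnd: "\<And>z. z \<in> ball 0 1 \<Longrightarrow> cmod (w z) \<le> 1"
    and W: "w has_fps_expansion W" and n: "n > 0"
  shows "cmod (fps_nth W n) \<le> 1 - (cmod (fps_nth W 0))\<^sup>2"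
proof -
  define a b where "a = fps_nth W 0" and "b = fps_nth W n"
  have ev: "\<forall>\<^sub>F r in at_left (1::real). cmod (of_real (r ^ n) * b + 2 * s * a) \<le> 1 + (cmod s)\<^sup>2" for s
    using eventually_at_left_real [of 0 1, OF zero_less_one] unfolding a_def b_def
    by eventually_elim (rule bounded_fps_coeff_kernel_bound [OF hol bnd W n], auto)
  have bound: "cmod (b + 2 * s * a) \<le> 1 + (cmod s)\<^sup>2" for s
  proof -
    have "((\<lambda>r. cmod (of_real (r ^ n) * b + 2 * s * a)) \<longlongrightarrow>
        cmod (of_real (1 ^ n) * b + 2 * s * a)) (at_left 1)"
      by (intro tendsto_intros)
    from tendsto_upperbound [OF this ev] show ?thesis by simp
  qed
  \<comment> \<open>A unimodular number with \<open>b = \<bar>b\<bar> u\<close>; the function \<open>sgn\<close> fails to provide it at \<open>b = 0\<close>.\<close>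
  obtain u where u: "cmod u = 1" "b = of_real (cmod b) * u"
  proof (cases "b = 0")
    case True then show ?thesis using that [of 1] by simp
  next
    case False show ?thesis
    proof (rule that [of "sgn b"])
      show "cmod (sgn b) = 1" using False by (simp add: norm_sgn)
      show "b = of_real (cmod b) * sgn b"
        using False by (simp add: sgn_eq)
    qed
  qed
  have "b + 2 * (cnj a * u) * a = of_real (cmod b + 2 * (cmod a)\<^sup>2) * u"
    by (subst u(2)) (simp add: algebra_simps complex_norm_square del: of_real_power)
  then have "cmod (b + 2 * (cnj a * u) * a) = cmod b + 2 * (cmod a)\<^sup>2"
    by (simp only: norm_mult u(1) norm_of_real) simp
  with bound [of "cnj a * u"] show ?thesis
    by (simp add: norm_mult u(1) flip: a_def b_def)
qed

section \<open>The coefficient estimate\<close>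

lemma q_diff_sums:
  assumes f: "\<And>z. z \<in> ball 0 1 \<Longrightarrow> (\<lambda>n. b n * z ^ n) sums f z"
    and q: "0 < q" "q < 1" and z: "z \<in> ball 0 1"
  shows "(\<lambda>n. b (Suc n) * of_real ((1 - q ^ Suc n) / (1 - q)) * z ^ n) sums q_diff q f z"
proof (cases "z = 0")
  case True
  have "f has_fps_expansion Abs_fps b"
    using f by (intro has_fps_expansionI eventually_nhds_in_open [THEN eventually_mono, of "ball 0 1"]) auto
  then have "deriv f 0 = b 1"
    using fps_nth_fps_expansion [of f "Abs_fps b" 1] by simp
  moreover have "(\<lambda>n. b (Suc n) * of_real ((1 - q ^ Suc n) / (1 - q)) * 0 ^ n) sums b 1"
    using powser_sums_zero [of "\<lambda>n. b (Suc n) * of_real ((1 - q ^ Suc n) / (1 - q))"] q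
    by simp
  ultimately show ?thesis
    using True by (simp add: q_diff_def)
next
  case False
  have "cmod (of_real q * z) \<le> 1 * cmod z"
    unfolding norm_mult using q by (intro mult_right_mono) auto
  then have qz: "of_real q * z \<in> ball 0 1"
    using z by simp
  have "(\<lambda>n. b n * z ^ n - b n * (of_real q * z) ^ n) sums (f z - f (of_real q * z))"
    by (intro sums_diff f z qz)
  then have "(\<lambda>n. b (Suc n) * z ^ Suc n - b (Suc n) * (of_real q * z) ^ Suc n)
      sums (f z - f (of_real q * z))"
    by (subst sums_Suc_iff) simp
  then have "(\<lambda>n. (b (Suc n) * z ^ Suc n - b (Suc n) * (of_real q * z) ^ Suc n) / (z * (1 - of_real q)))
      sums ((f z - f (of_real q * z)) / (z * (1 - of_real q)))"
    by (rule sums_divide)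
  moreover have "(b (Suc n) * z ^ Suc n - b (Suc n) * (of_real q * z) ^ Suc n) / (z * (1 - of_real q))
      = b (Suc n) * of_real ((1 - q ^ Suc n) / (1 - q)) * z ^ n" for n
  proof -
    have "1 - complex_of_real q \<noteq> 0"
      using q by (metis eq_iff_diff_eq_0 less_irrefl of_real_1 of_real_eq_iff)
    then show ?thesis
      using False by (simp add: field_simps power_mult_distrib)
  qed
  ultimately show ?thesis
    using False by (simp add: q_diff_def)
qed

text \<open>
  The difference sequence of \<open>d\<close> consists of the coefficients of \<open>p z = (1 - z) * D z\<close>, so the
  coefficients of \<open>D\<close> are recovered from it by summation. The disc
  \<open>\<bar>p - R\<bar> \<le> R\<close> is rescaled to the unit disc by \<open>p / R - 1\<close>, which turns
  the bound \<open>1 - \<bar>w\<^sub>0\<bar>\<^sup>2\<close> into \<open>R (1 - (1 / R - 1)\<^sup>2) = 2 - 1 / R\<close>.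
\<close>

lemma coeff_bound_of_one_minus_times:
  fixes d :: "nat \<Rightarrow> complex" and R :: real
  assumes D: "\<And>z. z \<in> ball 0 1 \<Longrightarrow> (\<lambda>n. d n * z ^ n) sums D z"
    and d0: "d 0 = 1" and R: "R > 0"
    and bnd: "\<And>z. z \<in> ball 0 1 \<Longrightarrow> cmod ((1 - z) * D z - of_real R) \<le> R"
  shows "cmod (d n) \<le> 1 + real n * (2 - 1 / R)"
proof -
  define w where "w = (\<lambda>z. of_real (1 / R) * ((1 - z) * D z) - 1)"
  define W where "W = fps_const (of_real (1 / R)) * ((1 - fps_X) * Abs_fps d) - 1"
  have "D has_fps_expansion Abs_fps d"
    using D by (intro has_fps_expansionI eventually_nhds_in_open [THEN eventually_mono, of "ball 0 1"]) auto
  then have W: "w has_fps_expansion W"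
    unfolding w_def W_def by (intro fps_expansion_intros)
  have "D holomorphic_on ball 0 1"
    using D by (intro power_series_holomorphic [of 0 1 d]) simp
  then have hol: "w holomorphic_on ball 0 1"
    unfolding w_def by (intro holomorphic_intros)
  have wb: "cmod (w z) \<le> 1" if "z \<in> ball 0 1" for z
  proof -
    have "w z = ((1 - z) * D z - of_real R) / of_real R"
      using R by (simp add: w_def field_simps)
    then show ?thesis
      using bnd [OF that] R by (simp add: norm_divide)
  qed
  have W0: "fps_nth W 0 = of_real (1 / R - 1)"
    by (simp add: W_def d0)
  have WS: "fps_nth W (Suc k) = of_real (1 / R) * (d (Suc k) - d k)" for k
    by (simp add: W_def left_diff_distrib)
  have step: "cmod (d (Suc k) - d k) \<le> 2 - 1 / R" for k
  proof -
    have "cmod (fps_nth W (Suc k)) \<le> 1 - (cmod (fps_nth W 0))\<^sup>2"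
      by (rule bounded_fps_coeff_le [OF hol wb W]) auto
    then have "1 / R * cmod (d (Suc k) - d k) \<le> 1 - (1 / R - 1)\<^sup>2"
      using R unfolding WS W0 norm_mult norm_of_real by simp
    also have "\<dots> = 1 / R * (2 - 1 / R)"
      by (simp add: power2_eq_square algebra_simps)
    finally show ?thesis
      using R by (simp add: divide_le_cancel)
  qed
  show ?thesis
  proof (induction n)
    case 0
    then show ?case by (simp add: d0)
  next
    case (Suc n)
    have "cmod (d (Suc n)) \<le> cmod (d n) + cmod (d (Suc n) - d n)"
      by (metis add.commute diff_add_cancel norm_triangle_ineq)
    with Suc step [of n] show ?case
      by (simp add: algebra_simps)
  qed
qed

theorem corollary3p5:
  fixes q :: real and f :: "complex \<Rightarrow> complex" and a :: "nat \<Rightarrow> complex"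
  assumes "0 < q" and "q < 1"
    and "\<And>z. z \<in> ball 0 1 \<Longrightarrow> (\<lambda>n. a (n + 2) * z ^ (n + 2)) sums (f z - z)"
    and "f \<in> class_K_with q (\<lambda>z. z / (1 - z))"
  shows "\<forall>n\<ge>2. cmod (a n) \<le> (1 - q) / (1 - q ^ n) * (real n + q * (real n - 1))"
proof (intro allI impI)
  fix n :: nat assume n: "n \<ge> 2"
  \<comment> \<open>The hypotheses leave \<open>a 0\<close> and \<open>a 1\<close> arbitrary; \<open>b\<close> carries the true coefficients \<open>0\<close> and \<open>1\<close>.\<close>
  define b where "b = (\<lambda>k. if k = 0 then 0 else if k = 1 then 1 else a k)"
  define d where "d = (\<lambda>k. b (Suc k) * of_real ((1 - q ^ Suc k) / (1 - q)))"
  have fb: "(\<lambda>k. b k * z ^ k) sums f z" if "z \<in> ball 0 1" for z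
  proof -
    have "(\<lambda>k. b (k + 2) * z ^ (k + 2)) sums (f z - (\<Sum>k<2. b k * z ^ k))"
      using assms(3) [OF that] by (simp add: b_def numeral_2_eq_2)
    then show ?thesis
      by (subst (asm) sums_iff_shift) simp
  qed
  have D: "(\<lambda>k. d k * z ^ k) sums q_diff q f z" if "z \<in> ball 0 1" for z
    unfolding d_def using fb assms(1,2) that by (rule q_diff_sums)
  have "cmod ((1 - z) * q_diff q f z - of_real (1 / (1 - q))) \<le> 1 / (1 - q)"
    if "z \<in> ball 0 1" for z
  proof -
    have "(if z = 0 then 1 else z / (z / (1 - z))) = 1 - z"
      by simp
    then show ?thesis
      using assms(4) that unfolding class_K_with_def by (fastforce simp del: divide_divide_eq_right)
  qed
  then have "cmod (d (n - 1)) \<le> 1 + real (n - 1) * (2 - 1 / (1 / (1 - q)))"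
    using assms(2) by (intro coeff_bound_of_one_minus_times [OF D]) (auto simp: d_def b_def)
  also have "\<dots> = real n + q * (real n - 1)"
    using n by (simp add: of_nat_diff algebra_simps)
  finally have dn: "cmod (d (n - 1)) \<le> real n + q * (real n - 1)" .
  have qn: "q ^ n < 1"
    using assms n by (simp add: power_Suc_less_one power_less_one_iff)
  have "cmod (d (n - 1)) = cmod (a n) * ((1 - q ^ n) / (1 - q))"
  proof -
    have "d (n - 1) = a n * of_real ((1 - q ^ n) / (1 - q))"
      using n by (cases n) (simp_all add: d_def b_def)
    then show ?thesis
      using qn assms(2) by (simp only: norm_mult norm_of_real) simp
  qed
  with dn have "cmod (a n) * ((1 - q ^ n) / (1 - q)) \<le> real n + q * (real n - 1)" by simp
  then show "cmod (a n) \<le> (1 - q) / (1 - q ^ n) * (real n + q * (real n - 1))"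
    using qn assms(2) by (simp add: field_simps)
qed

end
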